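(* Let $\Gamma=\{(a,b,a+_hb,h)\in\mathbb{C}^3\times\mathbb{R}_+\mid h>0,\ a\in\mathbb{C},\ b\in\mathbb{C}\}$. Then the intersection of $\mathbb{C}^3\times\{0\}$ with the closure of $\Gamma$ in $\mathbb{C}^3\times\mathbb{R}_+$ is $\Gamma_{\smile}\times\{0\}$, where $\Gamma_{\smile}=\{(a,b,c)\in\mathbb{C}^3\mid c\in a\smile b\}$ is the graph of the tropical addition $(a,b)\mapsto a\smile b$ of complex numbers.
   Context: $\mathbb{R}_+=[0,\infty)$. For a real number $h>0$, $S_h:\mathbb{C}\to\mathbb{C}$ is the bijection with $S_h(0)=0$ and $S_h(z)=|z|^{1/h}\frac{z}{|z|}$ for $z\ne0$; its inverse is $S_h^{-1}(0)=0$, $S_h^{-1}(z)=|z|^{h}\frac{z}{|z|}$ for $z\neq 0$. The operation $+_h$ on $\mathbb{C}$ is $a+_hb=S_h^{-1}(S_h(a)+S_h(b))$. Tropical addition on $\mathbb{C}$ is the multivalued operation $\smile$ defined by: if $|a|>|b|$, then $a\smile b=\{a\}$; if $|a|<|b|$, then $a\smile b=\{b\}$; if $|a|=|b|$ and $a+b\ne0$, then $a\smile b$ is the set of all complex numbers on the (closed) shortest arc connecting $a$ with $b$ on the circle $\{z\mid|z|=|a|\}$, i.e. if $a=re^{\alpha i}$, $b=re^{\beta i}$ with $|\beta-\alpha|<\pi$, then $a\smile b=\{re^{\varphi i}\mid|\alpha-\varphi|+|\varphi-\beta|=|\alpha-\beta|\}$; if $a+b=0$, then $a\smile b$ is the closed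 disk $\{c\in\mathbb{C}\mid|c|\le|a|\}$. *)

theory Defs
  imports "HOL-Analysis.Analysis"
begin

text \<open>
  The map \<open>S_map h\<close> is meant for \<open>h > 0\<close> only; it is then a bijection of the complex plane
  (\<open>bij_S_map\<close>), and its inverse is given by the expected formula (\<open>inv_S_map\<close>).
\<close>

definition S_map :: "real \<Rightarrow> complex \<Rightarrow> complex" where
  "S_map h z = (if z = 0 then 0 else of_real (cmod z powr (1 / h)) * (z / of_real (cmod z)))"

definition h_add :: "real \<Rightarrow> complex \<Rightarrow> complex \<Rightarrow> complex" where
  "h_add h a b = inv (S_map h) (S_map h a + S_map h b)"

text \<open>
  In the third case of \<open>trop_add\<close> we have \<open>a \<noteq> 0\<close>, and arguments \<open>\<alpha>\<close>, \<open>\<beta>\<close> of \<open>a\<close>, \<open>b\<close> with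
  \<open>\<bar>\<beta> - \<alpha>\<bar> < pi\<close> exist and are unique up to a common multiple of \<open>2 * pi\<close>.  The set is
  therefore the same for each choice of them; see \<open>trop_add_arc\<close>.
\<close>

definition trop_add :: "complex \<Rightarrow> complex \<Rightarrow> complex set" where
  "trop_add a b =
     (if cmod a > cmod b then {a}
      else if cmod a < cmod b then {b}
      else if a + b \<noteq> 0 then
        {rcis (cmod a) \<phi> | \<alpha> \<beta> \<phi>.
           a = rcis (cmod a) \<alpha> \<and> b = rcis (cmod a) \<beta> \<and> \<bar>\<beta> - \<alpha>\<bar> < pi \<and>
           \<bar>\<alpha> - \<phi>\<bar> + \<bar>\<phi> - \<beta>\<bar> = \<bar>\<alpha> - \<beta>\<bar>}
      else {c. cmod c \<le> cmod a})"

definition h_add_graphs :: "((complex \<times> complex \<times> complex) \<times> real) set" where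
  "h_add_graphs = {((a, b, h_add h a b), h) | a b h. h > 0}"

definition trop_add_graph :: "(complex \<times> complex \<times> complex) set" where
  "trop_add_graph = {(a, b, c). c \<in> trop_add a b}"


lemma
  assumes "h > 0"
  shows bij_S_map: "bij (S_map h)"
    and inv_S_map: "inv (S_map h) z =
      (if z = 0 then 0 else of_real (cmod z powr h) * (z / of_real (cmod z)))"
proof -
  define T where "T z = (if z = 0 then 0 else of_real (cmod z powr h) * (z / of_real (cmod z)))"
    for z :: complex
  have nS: "cmod (S_map h z) = cmod z powr (1 / h)" if "z \<noteq> 0" for z
    using that by (simp add: S_map_def norm_mult norm_divide)
  have nT: "cmod (T z) = cmod z powr h" if "z \<noteq> 0" for z
    using that by (simp add: T_def norm_mult norm_divide)
  have TS: "T (S_map h z) = z" for z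
  proof (cases "z = 0")
    case False
    then have "S_map h z \<noteq> 0" by (simp add: S_map_def)
    then have "T (S_map h z) = of_real (cmod z) * (S_map h z / of_real (cmod z powr (1 / h)))"
      using False assms by (simp add: T_def nS powr_powr)
    then show ?thesis using False by (simp add: S_map_def)
  qed (simp add: S_map_def T_def)
  have ST: "S_map h (T z) = z" for z
  proof (cases "z = 0")
    case False
    then have "T z \<noteq> 0" by (simp add: T_def)
    then have "S_map h (T z) = of_real (cmod z) * (T z / of_real (cmod z powr h))"
      using False assms by (simp add: S_map_def nT powr_powr)
    then show ?thesis using False by (simp add: T_def)
  qed (simp add: S_map_def T_def)
  show "bij (S_map h)" by (rule o_bij[of T]) (auto simp: TS ST)
  have "inv (S_map h) = T" by (rule inv_equality) (auto simp: TS ST)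
  then show "inv (S_map h) z =
      (if z = 0 then 0 else of_real (cmod z powr h) * (z / of_real (cmod z)))"
    by (simp add: T_def)
qed

lemma trop_add_arc:
  assumes r: "r > 0" and lt: "\<bar>\<beta> - \<alpha>\<bar> < pi"
  shows "trop_add (rcis r \<alpha>) (rcis r \<beta>) =
    {rcis r \<phi> | \<phi>. \<bar>\<alpha> - \<phi>\<bar> + \<bar>\<phi> - \<beta>\<bar> = \<bar>\<alpha> - \<beta>\<bar>}"
proof -
  have eqD: "\<exists>k::int. x = y + 2 * pi * of_int k" if "rcis r x = rcis r y" for x y
    using that r by (simp add: rcis_def complex_eq_iff flip: sin_cos_eq_iff)
  have ne: "rcis r \<alpha> + rcis r \<beta> \<noteq> 0"
  proof
    assume "rcis r \<alpha> + rcis r \<beta> = 0"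
    then have "rcis r \<alpha> = rcis r (\<beta> + pi)"
      by (simp add: rcis_def complex_eq_iff algebra_simps)
    then obtain k :: int where k: "\<alpha> = \<beta> + pi + 2 * pi * of_int k"
      using eqD by blast
    then have "\<beta> - \<alpha> = pi * of_int (- 1 - 2 * k)"
      by (simp add: algebra_simps)
    then have "pi * \<bar>of_int (- 1 - 2 * k)\<bar> < pi * 1"
      using lt by (simp add: abs_mult)
    then have "\<bar>of_int (- 1 - 2 * k) :: real\<bar> < 1"
      by (rule mult_left_less_imp_less) simp
    then have "\<bar>- 1 - 2 * k\<bar> < 1"
      by (simp only: of_int_abs[symmetric] of_int_less_1_iff)
    then show False by presburger
  qed
  have shift: "\<exists>\<psi>. rcis r \<phi> = rcis r \<psi> \<and> \<bar>\<alpha> - \<psi>\<bar> + \<bar>\<psi> - \<beta>\<bar> = \<bar>\<alpha> - \<beta>\<bar>"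
    if args: "rcis r \<alpha> = rcis r \<alpha>'" "rcis r \<beta> = rcis r \<beta>'" "\<bar>\<beta>' - \<alpha>'\<bar> < pi"
      "\<bar>\<alpha>' - \<phi>\<bar> + \<bar>\<phi> - \<beta>'\<bar> = \<bar>\<alpha>' - \<beta>'\<bar>" for \<alpha>' \<beta>' \<phi>
  proof -
    obtain k m :: int where k: "\<alpha> = \<alpha>' + 2 * pi * of_int k" and m: "\<beta> = \<beta>' + 2 * pi * of_int m"
      using eqD[OF args(1)] eqD[OF args(2)] by blast
    have "\<bar>2 * pi * of_int (k - m)\<bar> < 2 * pi"
      using lt args(3) k m by (simp add: algebra_simps abs_less_iff)
    then have "\<bar>of_int (k - m) :: real\<bar> < 1"
      by (simp add: abs_mult)
    then have "k = m" by linarith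
    then show ?thesis using k m args(4)
      by (intro exI[of _ "\<phi> + 2 * pi * of_int k"])
         (auto simp: rcis_def complex_eq_iff sin_add cos_add)
  qed
  show ?thesis
    using r ne lt by (auto simp: trop_add_def dest: shift)
qed

end

theory Submission
  imports Defs "HOL-Real_Asymp.Real_Asymp"
begin

text \<open>
  Write \<open>S\<^sub>h a + S\<^sub>h b = M w\<close> with \<open>M = \<bar>S\<^sub>h a\<bar> + \<bar>S\<^sub>h b\<bar>\<close>.  Then \<open>w\<close> is a convex combination
  \<open>(1 - t) a / \<bar>a\<bar> + t b / \<bar>b\<bar>\<close>, and \<open>a +\<^sub>h b = M\<^sup>h \<bar>w\<bar>\<^sup>h w / \<bar>w\<bar>\<close>.  With \<open>m = max \<bar>a\<bar> \<bar>b\<bar>\<close> we have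
  \<open>m \<le> M\<^sup>h \<le> 2\<^sup>h m\<close>, so \<open>a +\<^sub>h b\<close> is asymptotic to \<open>m w / \<bar>w\<bar>\<close> for \<open>h \<rightarrow> 0\<close> as long as \<open>w\<close> stays away
  from \<open>0\<close>.  If \<open>\<bar>a\<bar> > \<bar>b\<bar>\<close>, then \<open>t \<rightarrow> 0\<close>.  If \<open>\<bar>a\<bar> = \<bar>b\<bar>\<close> and \<open>a + b \<noteq> 0\<close>, then the directions of
  the convex combinations of \<open>a\<close> and \<open>b\<close> fill precisely the shortest arc, and each \<open>t\<close> strictly between
  \<open>0\<close> and \<open>1\<close> is attained by rescaling \<open>a\<close> and \<open>b\<close> by \<open>(1 - t)\<^sup>h\<close> and \<open>t\<^sup>h\<close>.  If \<open>b = - a\<close>, then only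
  \<open>\<bar>c\<bar> \<le> \<bar>a\<bar>\<close> survives in the limit, and a point \<open>c\<close> of the open disk is attained exactly by
  \<open>a +\<^sub>h x = c\<close> with \<open>x = c +\<^sub>h (- a) \<rightarrow> - a\<close>.  The remaining points are limits of points already covered.
\<close>

section \<open>The map \<open>S_map h\<close> in polar form\<close>

lemma S_map_sgn: "S_map h z = of_real (cmod z powr (1 / h)) * sgn z"
  by (simp add: S_map_def sgn_eq)

lemma cmod_S_map: "cmod (S_map h z) = cmod z powr (1 / h)"
  by (simp add: S_map_sgn norm_mult norm_sgn)

lemma S_map_minus: "S_map h (- z) = - S_map h z"
  by (simp add: S_map_sgn sgn_minus)

text \<open>Moduli enter through the power \<open>1 / h\<close>, which undoes the exponent
  \<open>h\<close>. This is how prescribed convex weights are realised on the arc.\<close>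

lemma S_map_powr_mult:
  assumes "h > 0" "t > 0"
  shows "S_map h (of_real (t powr h) * z) = of_real t * S_map h z"
  using assms by (simp add: S_map_sgn norm_mult sgn_mult powr_mult powr_powr sgn_of_real)

lemma inv_S_map_sgn: "h > 0 \<Longrightarrow> inv (S_map h) z = of_real (cmod z powr h) * sgn z"
  by (simp add: inv_S_map sgn_eq)

lemma h_add_commute: "h_add h a b = h_add h b a"
  by (simp add: h_add_def add.commute)

lemma h_add_zero: "h > 0 \<Longrightarrow> h_add h 0 0 = 0"
  by (simp add: h_add_def S_map_sgn inv_S_map_sgn)

section \<open>Mass and mean of the summed images\<close>

definition S_mass :: "real \<Rightarrow> complex \<Rightarrow> complex \<Rightarrow> real" where
  "S_mass h a b = cmod (S_map h a) + cmod (S_map h b)"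

text \<open>
  At \<open>a = b = 0\<close> the quotient is \<open>0 / 0 = 0\<close>.
\<close>

definition S_mean :: "real \<Rightarrow> complex \<Rightarrow> complex \<Rightarrow> complex" where
  "S_mean h a b = (S_map h a + S_map h b) / of_real (S_mass h a b)"

lemma S_mass_nonneg: "S_mass h a b \<ge> 0"
  by (simp add: S_mass_def)

lemma S_mass_ge: "cmod (S_map h a) \<le> S_mass h a b" "cmod (S_map h b) \<le> S_mass h a b"
  by (simp_all add: S_mass_def)

lemma S_mass_eq_0_iff: "S_mass h a b = 0 \<longleftrightarrow> a = 0 \<and> b = 0"
  by (auto simp: S_mass_def cmod_S_map add_nonneg_eq_0_iff)

lemma S_map_add_eq: "S_map h a + S_map h b = of_real (S_mass h a b) * S_mean h a b"
  \<comment> \<open>With zero mass both arguments vanish, so both sides are 0.\<close>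
  by (cases "S_mass h a b = 0") (auto simp: S_mean_def S_mass_eq_0_iff S_map_def)

lemma cmod_S_mean_le: "cmod (S_mean h a b) \<le> 1"
  using norm_triangle_ineq[of "S_map h a" "S_map h b", folded S_mass_def] S_mass_nonneg[of h a b]
  by (auto simp: S_mean_def norm_divide divide_le_eq_1 less_le)

text \<open>The inverse of \<open>S_map h\<close> is multiplicative. Mass and mean are kept apart
  because their powers have different limits: the first tends to the larger modulus, the second to 1
  when the mean stays away from 0.\<close>

lemma h_add_eq:
  assumes "h > 0"
  shows "h_add h a b =
    of_real (S_mass h a b powr h * cmod (S_mean h a b) powr h) * sgn (S_mean h a b)"
proof (cases "S_mass h a b = 0")
  case True
  then have "a = 0" "b = 0" by (simp_all add: S_mass_eq_0_iff)
  then show ?thesis using assms by (simp add: h_add_zero S_mass_def S_map_def)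
next
  case False
  then have "S_mass h a b > 0" using S_mass_nonneg[of h a b] by simp
  then show ?thesis
    using assms
    by (simp add: h_add_def inv_S_map_sgn S_map_add_eq norm_mult sgn_mult powr_mult sgn_of_real)
qed

lemma S_mass_powr_ge:
  assumes "h > 0"
  shows "max (cmod a) (cmod b) \<le> S_mass h a b powr h"
proof -
  have "cmod (S_map h a) powr h \<le> S_mass h a b powr h"
    "cmod (S_map h b) powr h \<le> S_mass h a b powr h"
    using assms by (auto intro!: powr_mono2 simp: S_mass_def)
  then show ?thesis using assms by (simp add: cmod_S_map powr_powr)
qed

text \<open>Each of the two summands of the mass is at most \<open>m powr (1 / h)\<close>, where
  \<open>m\<close> is the larger modulus.\<close>

lemma S_mass_powr_le:
  assumes "h > 0"
  shows "S_mass h a b powr h \<le> 2 powr h * max (cmod a) (cmod b)"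
proof -
  define m where "m = max (cmod a) (cmod b)"
  have "cmod a powr (1 / h) \<le> m powr (1 / h)" "cmod b powr (1 / h) \<le> m powr (1 / h)"
    using assms by (auto intro!: powr_mono2 simp: m_def)
  then have "S_mass h a b powr h \<le> (2 * m powr (1 / h)) powr h"
    using assms by (intro powr_mono2) (auto simp: S_mass_def cmod_S_map)
  also have "\<dots> = 2 powr h * m"
    using assms by (simp add: powr_mult powr_powr m_def le_max_iff_disj)
  finally show ?thesis by (simp add: m_def)
qed

section \<open>Limits as the parameter tends to 0 from the right\<close>

lemma filterlim_at_right_0_pos:
  "filterlim h (at_right (0::real)) F \<Longrightarrow> \<forall>\<^sub>F x in F. h x > 0"
  unfolding filterlim_at by (auto elim: eventually_mono)

lemma filterlim_at_right_0_tendsto: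
  "filterlim h (at_right (0::real)) F \<Longrightarrow> (h \<longlongrightarrow> 0) F"
  by (simp add: filterlim_at)

lemma tendsto_S_mass_powr:
  assumes h: "filterlim h (at_right 0) F" and a: "(a \<longlongrightarrow> a') F" and b: "(b \<longlongrightarrow> b') F"
  shows "((\<lambda>x. S_mass (h x) (a x) (b x) powr h x) \<longlongrightarrow> max (cmod a') (cmod b')) F"
proof (rule tendsto_sandwich)
  note pos = filterlim_at_right_0_pos[OF h] and h0 = filterlim_at_right_0_tendsto[OF h]
  show "\<forall>\<^sub>F x in F. max (cmod (a x)) (cmod (b x)) \<le> S_mass (h x) (a x) (b x) powr h x"
    using pos by eventually_elim (rule S_mass_powr_ge)
  show "\<forall>\<^sub>F x in F. S_mass (h x) (a x) (b x) powr h x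
      \<le> 2 powr h x * max (cmod (a x)) (cmod (b x))"
    using pos by eventually_elim (rule S_mass_powr_le)
  show "((\<lambda>x. max (cmod (a x)) (cmod (b x))) \<longlongrightarrow> max (cmod a') (cmod b')) F"
    by (intro tendsto_intros a b)
  have "((\<lambda>x. 2 powr h x * max (cmod (a x)) (cmod (b x)))
      \<longlongrightarrow> 2 powr 0 * max (cmod a') (cmod b')) F"
    by (intro tendsto_intros a b h0) auto
  then show "((\<lambda>x. 2 powr h x * max (cmod (a x)) (cmod (b x)))
      \<longlongrightarrow> max (cmod a') (cmod b')) F"
    by simp
qed

lemma tendsto_h_add:
  assumes h: "filterlim h (at_right 0) F" and a: "(a \<longlongrightarrow> a') F" and b: "(b \<longlongrightarrow> b') F"
    and w: "((\<lambda>x. S_mean (h x) (a x) (b x)) \<longlongrightarrow> w) F" and "w \<noteq> 0"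
  shows "((\<lambda>x. h_add (h x) (a x) (b x)) \<longlongrightarrow> of_real (max (cmod a') (cmod b')) * sgn w) F"
proof -
  note pos = filterlim_at_right_0_pos[OF h] and h0 = filterlim_at_right_0_tendsto[OF h]
  \<comment> \<open>Since \<open>w\<close> is nonzero, \<open>cmod w powr 0\<close> is 1 and
    \<open>sgn\<close> is continuous at \<open>w\<close>.\<close>
  have "((\<lambda>x. of_real (S_mass (h x) (a x) (b x) powr h x * cmod (S_mean (h x) (a x) (b x)) powr h x)
      * sgn (S_mean (h x) (a x) (b x))) \<longlongrightarrow>
      of_real (max (cmod a') (cmod b') * cmod w powr 0) * sgn w) F"
    using \<open>w \<noteq> 0\<close> by (intro tendsto_intros tendsto_S_mass_powr h a b w h0) auto
  moreover have "\<forall>\<^sub>F x in F.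
      of_real (S_mass (h x) (a x) (b x) powr h x * cmod (S_mean (h x) (a x) (b x)) powr h x)
      * sgn (S_mean (h x) (a x) (b x)) = h_add (h x) (a x) (b x)"
    using pos by eventually_elim (simp only: h_add_eq)
  ultimately show ?thesis
    using \<open>w \<noteq> 0\<close> by (auto simp: elim: Lim_transform_eventually)
qed

text \<open>This serves the case of opposite limits, where the mean may tend to 0 and its direction
  is uncontrolled. The mean has modulus at most 1, so the mass alone bounds the sum.\<close>

lemma cmod_h_add_limit_le:
  assumes h: "filterlim h (at_right 0) F" and a: "(a \<longlongrightarrow> a') F" and b: "(b \<longlongrightarrow> b') F"
    and c: "((\<lambda>x. h_add (h x) (a x) (b x)) \<longlongrightarrow> c) F" and "F \<noteq> bot"
  shows "cmod c \<le> max (cmod a') (cmod b')"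
proof (rule tendsto_le[OF \<open>F \<noteq> bot\<close> tendsto_S_mass_powr[OF h a b] tendsto_norm[OF c]])
  show "\<forall>\<^sub>F x in F. cmod (h_add (h x) (a x) (b x)) \<le> S_mass (h x) (a x) (b x) powr h x"
    using filterlim_at_right_0_pos[OF h]
  proof eventually_elim
    case (elim x)
    have "cmod (S_mean (h x) (a x) (b x)) powr h x \<le> 1"
      using elim cmod_S_mean_le powr_mono2[of "h x" "cmod (S_mean (h x) (a x) (b x))" 1] by simp
    then show ?case
      using elim mult_left_mono[of _ 1 "S_mass (h x) (a x) (b x) powr h x"]
      by (auto simp: h_add_eq norm_mult norm_sgn)
  qed
qed

text \<open>The images have modulus ratio \<open>(cmod b / cmod a) powr (1 / h)\<close>. The base
  eventually stays below a constant less than 1 while the exponent tends to infinity, so the smaller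
  argument loses all weight.\<close>

lemma tendsto_S_mean_dominant:
  assumes h: "filterlim h (at_right 0) F" and a: "(a \<longlongrightarrow> a') F" and b: "(b \<longlongrightarrow> b') F"
    and less: "cmod b' < cmod a'"
  shows "((\<lambda>x. S_mean (h x) (a x) (b x)) \<longlongrightarrow> sgn a') F"
proof -
  have "a' \<noteq> 0" using less by auto
  have "cmod b' / cmod a' < 1" using less by (simp add: divide_less_eq)
  \<comment> \<open>The moduli vary along the filter; a gap on both sides of \<open>q\<close> gives
    one bound for all late ratios.\<close>
  then obtain q where q: "cmod b' / cmod a' < q" "q < 1"
    using dense by blast
  then have "q > 0"
    using le_less_trans[of 0 "cmod b' / cmod a'" q] by simp
  note pos = filterlim_at_right_0_pos[OF h] and h0 = filterlim_at_right_0_tendsto[OF h]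
  have a0: "\<forall>\<^sub>F x in F. a x \<noteq> 0"
    using a \<open>a' \<noteq> 0\<close> by (rule tendsto_imp_eventually_ne)
  have "((\<lambda>x. cmod (b x) / cmod (a x)) \<longlongrightarrow> cmod b' / cmod a') F"
    using \<open>a' \<noteq> 0\<close> by (intro tendsto_intros a b) auto
  then have ratio: "\<forall>\<^sub>F x in F. cmod (b x) / cmod (a x) < q"
    using q(1) by (rule order_tendstoD)
  have inf: "filterlim (\<lambda>x. 1 / h x) at_top F"
    using filterlim_compose[OF filterlim_inverse_at_top_right h] by (simp add: inverse_eq_divide)
  have "((\<lambda>y. q powr y) \<longlongrightarrow> 0) at_top"
    using \<open>q > 0\<close> q(2) by real_asymp
  then have q0: "((\<lambda>x. q powr (1 / h x)) \<longlongrightarrow> 0) F"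
    using inf by (rule filterlim_compose)
  have S0: "((\<lambda>x. cmod (S_map (h x) (b x)) / cmod (S_map (h x) (a x))) \<longlongrightarrow> 0) F"
  proof (rule tendsto_sandwich[OF _ _ tendsto_const q0])
    show "\<forall>\<^sub>F x in F. cmod (S_map (h x) (b x)) / cmod (S_map (h x) (a x)) \<le> q powr (1 / h x)"
      using pos a0 ratio
    proof eventually_elim
      case (elim x)
      then have "(cmod (b x) / cmod (a x)) powr (1 / h x) \<le> q powr (1 / h x)"
        by (intro powr_mono2) auto
      then show ?case by (simp add: cmod_S_map powr_divide)
    qed
  qed auto
  have "((\<lambda>x. S_map (h x) (b x) / of_real (cmod (S_map (h x) (a x)))) \<longlongrightarrow> 0) F"
    by (rule tendsto_norm_zero_cancel) (use S0 in \<open>simp add: norm_divide\<close>)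
  \<comment> \<open>This is \<open>S_mean\<close> with numerator and denominator divided by the
    modulus of the dominant image.\<close>
  then have "((\<lambda>x. (sgn (a x) + S_map (h x) (b x) / of_real (cmod (S_map (h x) (a x)))) /
      of_real (1 + cmod (S_map (h x) (b x)) / cmod (S_map (h x) (a x))))
      \<longlongrightarrow> (sgn a' + 0) / of_real (1 + 0)) F"
    using S0 \<open>a' \<noteq> 0\<close> by (intro tendsto_intros a) auto
  moreover have "\<forall>\<^sub>F x in F. (sgn (a x) + S_map (h x) (b x) / of_real (cmod (S_map (h x) (a x)))) /
      of_real (1 + cmod (S_map (h x) (b x)) / cmod (S_map (h x) (a x)))
      = S_mean (h x) (a x) (b x)"
    using a0
  proof eventually_elim
    case (elim x)
    define s where "s = cmod (S_map (h x) (a x))"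
    have "s > 0" using elim by (simp add: s_def cmod_S_map)
    have "S_map (h x) (a x) = of_real s * sgn (a x)"
      unfolding s_def cmod_S_map by (rule S_map_sgn)
    then have "S_map (h x) (a x) + S_map (h x) (b x)
        = of_real s * (sgn (a x) + S_map (h x) (b x) / of_real s)"
      using \<open>s > 0\<close> by (simp add: field_simps)
    moreover have "S_mass (h x) (a x) (b x) = s * (1 + cmod (S_map (h x) (b x)) / s)"
      using \<open>s > 0\<close> by (simp add: field_simps S_mass_def s_def)
    ultimately show ?case
      using \<open>s > 0\<close> by (simp add: S_mean_def flip: s_def)
  qed
  ultimately show ?thesis
    by (auto elim: Lim_transform_eventually)
qed

lemma tendsto_h_add_dominant:
  assumes "filterlim h (at_right 0) F" "(a \<longlongrightarrow> a') F" "(b \<longlongrightarrow> b') F" "cmod b' < cmod a'"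
  shows "((\<lambda>x. h_add (h x) (a x) (b x)) \<longlongrightarrow> a') F"
proof -
  have "((\<lambda>x. h_add (h x) (a x) (b x)) \<longlongrightarrow> of_real (max (cmod a') (cmod b')) * sgn (sgn a')) F"
    using assms by (intro tendsto_h_add tendsto_S_mean_dominant) (auto simp: sgn_zero_iff)
  moreover have "of_real (max (cmod a') (cmod b')) * sgn (sgn a') = a'"
    using assms(4) by (auto simp: max_def sgn_eq norm_divide)
  ultimately show ?thesis by simp
qed

section \<open>Segments between points of equal modulus, and arcs\<close>

text \<open>If the segment met 0, comparing moduli would force \<open>t = 1 / 2\<close> and hence
  \<open>a + b = 0\<close>.\<close>

lemma segment_ne_0:
  fixes a b :: complex
  assumes "cmod a = cmod b" "a + b \<noteq> 0" "0 \<le> t" "t \<le> 1"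
  shows "of_real (1 - t) * a + of_real t * b \<noteq> 0"
proof
  assume eq: "of_real (1 - t) * a + of_real t * b = 0"
  then have "of_real (1 - t) * a = - (of_real t * b)"
    by (simp add: add_eq_0_iff2)
  then have "(1 - t) * cmod a = t * cmod b"
    using assms(3,4) by (metis abs_of_nonneg diff_ge_0_iff_ge norm_minus_cancel norm_mult norm_of_real)
  moreover have "cmod b > 0" using assms by auto
  ultimately have "1 - t = t" using assms(1) by simp
  then have "of_real t * a + of_real t * b = 0" using eq by (simp only:)
  then have "of_real t * (a + b) = 0" by (simp only: distrib_left)
  then show False using assms(2) \<open>1 - t = t\<close> by simp
qed

text \<open>Means combine the unit vectors of the arguments, while the arc is described by the
  segment between the arguments themselves; this converts one into the other.\<close>

lemma scaled_sgn_combination: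
  fixes a b :: complex
  assumes "cmod a = cmod b"
  shows "of_real (cmod a) * (of_real s * sgn a + of_real t * sgn b) = of_real s * a + of_real t * b"
proof -
  have "of_real (cmod a) * sgn a = a" "of_real (cmod a) * sgn b = b"
    using assms by (auto simp: sgn_eq)
  then show ?thesis by (simp only: distrib_left mult.left_commute[of "of_real (cmod a)"])
qed

text \<open>After division by \<open>sin d\<close> these are the real coordinates of
  \<open>cis \<psi>\<close> in the basis \<open>1\<close>, \<open>cis d\<close>.\<close>

lemma cis_arc_combination:
  "of_real (sin d) * cis \<psi> = of_real (sin (d - \<psi>)) + of_real (sin \<psi>) * cis d"
  by (simp add: complex_eq_iff sin_diff algebra_simps)

lemma arc_between_iff:
  fixes d \<psi> :: real
  shows "\<bar>\<psi>\<bar> + \<bar>\<psi> - d\<bar> = \<bar>d\<bar> \<longleftrightarrow> 0 \<le> \<psi> \<and> \<psi> \<le> d \<or> d \<le> \<psi> \<and> \<psi> \<le> 0"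
  by arith

text \<open>From left to right, a point of the arc has nonnegative coordinates with respect to the
  end points \<open>1\<close> and \<open>cis d\<close>; normalising them gives convex weights. From
  right to left, the signs of two sines confine the argument of a convex combination to the range
  between 0 and \<open>d\<close>.\<close>

lemma cis_arc_iff:
  assumes d: "\<bar>d\<bar> < pi"
  shows "(\<exists>\<psi>. c = cis \<psi> \<and> \<bar>\<psi>\<bar> + \<bar>\<psi> - d\<bar> = \<bar>d\<bar>) \<longleftrightarrow>
    (\<exists>t\<in>{0..1}. c = sgn (of_real (1 - t) + of_real t * cis d))"
    (is "?L \<longleftrightarrow> ?R")
proof (cases "d = 0")
  \<comment> \<open>The arc is a single point; the coordinates used otherwise divide by
    \<open>sin d\<close>.\<close>
  case True
  then show ?thesis by (auto intro: exI[of _ 0] bexI[of _ 0])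
next
  case False
  have sin_pos: "sin x > 0" if "0 < x" "x < pi" for x :: real
    using that by (rule sin_gt_zero)
  show ?thesis
  proof
    assume ?L
    then obtain \<psi> where c: "c = cis \<psi>" and \<psi>: "0 \<le> \<psi> \<and> \<psi> \<le> d \<or> d \<le> \<psi> \<and> \<psi> \<le> 0"
      by (auto simp: arc_between_iff)
    define l where "l = sin (d - \<psi>) / sin d"
    define m where "m = sin \<psi> / sin d"
    have "sin d \<noteq> 0" using False d sin_pos[of d] sin_pos[of "- d"] by (cases "d > 0") auto
    \<comment> \<open>All three sines have weakly the same sign, so both quotients are
      nonnegative.\<close>
    have "sin d > 0 \<and> sin (d - \<psi>) \<ge> 0 \<and> sin \<psi> \<ge> 0 \<or> sin d < 0 \<and> sin (d - \<psi>) \<le> 0 \<and> sin \<psi> \<le> 0"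
    proof (cases "d > 0")
      case True
      then show ?thesis using \<psi> d by (auto intro!: sin_ge_zero sin_pos)
    next
      case False
      then have "sin (- d) > 0" "sin (\<psi> - d) \<ge> 0" "sin (- \<psi>) \<ge> 0"
        using \<psi> d \<open>d \<noteq> 0\<close> by (auto intro!: sin_ge_zero sin_pos simp del: sin_minus)
      then show ?thesis using sin_minus[of "d - \<psi>"] by auto
    qed
    then have lm: "l \<ge> 0" "m \<ge> 0"
      by (auto simp: l_def m_def zero_le_divide_iff divide_nonpos_neg)
    have eq: "cis \<psi> = of_real l + of_real m * cis d"
      using cis_arc_combination[of d \<psi>] \<open>sin d \<noteq> 0\<close>
      by (simp add: l_def m_def field_simps)
    have "l + m \<noteq> 0"
    proof
      assume "l + m = 0"
      then have "l = 0" "m = 0" using lm by auto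
      then show False using eq by simp
    qed
    then have "l + m > 0" using lm by simp
    \<comment> \<open>Dividing by the sum of the coordinates changes only the length, which
      \<open>sgn\<close> discards.\<close>
    define t where "t = m / (l + m)"
    have "t \<in> {0..1}" using lm \<open>l + m > 0\<close> by (simp add: t_def)
    moreover have "of_real (1 - t) + of_real t * cis d = of_real (1 / (l + m)) * cis \<psi>"
    proof -
      have "1 - t = 1 / (l + m) * l" "t = 1 / (l + m) * m"
        using \<open>l + m > 0\<close> by (simp_all add: t_def field_simps)
      then show ?thesis unfolding eq by (simp only: of_real_mult distrib_left mult.assoc)
    qed
    then have "c = sgn (of_real (1 - t) + of_real t * cis d)"
      using \<open>l + m > 0\<close> by (simp only: sgn_mult sgn_of_real c) (simp add: sgn_eq)
    ultimately show ?R by blast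
  next
    assume ?R
    then obtain t where t: "0 \<le> t" "t \<le> 1" and c: "c = sgn (of_real (1 - t) + of_real t * cis d)"
      by auto
    define w where "w = of_real (1 - t) + of_real t * cis d"
    have "1 + cis d \<noteq> 0"
    proof
      assume "1 + cis d = 0"
      then have "cos \<bar>d\<bar> = cos pi" by (simp add: complex_eq_iff add_eq_0_iff)
      then show False using cos_monotone_0_pi[of "\<bar>d\<bar>" pi] d by simp
    qed
    then have "w \<noteq> 0"
      using segment_ne_0[of 1 "cis d" t] t by (simp add: w_def)
    then have r: "cmod w > 0" by simp
    define \<psi> where "\<psi> = Arg w"
    have rng: "- pi < \<psi>" "\<psi> \<le> pi" using Arg_bounded[of w] by (auto simp: \<psi>_def)
    have cw: "cis \<psi> = sgn w" using cis_Arg[OF \<open>w \<noteq> 0\<close>] by (simp add: \<psi>_def)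
    have w: "w = of_real (cmod w) * cis \<psi>" by (simp add: cw sgn_eq)
    have s1: "cmod w * sin \<psi> = t * sin d"
      using arg_cong[OF w, of Im] by (simp add: w_def)
    \<comment> \<open>Rotation by \<open>- d\<close> puts the other end point on the real axis, so
      the imaginary part shows on which side of it \<open>w\<close> lies.\<close>
    have "Im (w * cis (- d)) = cmod w * sin (\<psi> - d)"
      by (subst w) (simp add: sin_diff algebra_simps)
    moreover have "Im (w * cis (- d)) = - ((1 - t) * sin d)"
      by (simp add: w_def algebra_simps)
    ultimately have s2: "cmod w * sin (\<psi> - d) = - ((1 - t) * sin d)" by simp
    \<comment> \<open>The range of \<open>Arg\<close> includes \<open>pi\<close>, where the sine
      vanishes and its sign could not exclude a positive \<open>\<psi>\<close> for negative
      \<open>d\<close>. Here it would give \<open>t = 0\<close>, thus \<open>w = 1\<close> with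
      argument 0.\<close>
    have "\<psi> \<noteq> pi"
    proof
      assume "\<psi> = pi"
      then have "t * sin d = 0" using s1 by simp
      moreover have "sin d \<noteq> 0" using False d sin_pos[of d] sin_pos[of "- d"] by (cases "d > 0") auto
      ultimately have "t = 0" by simp
      then show False using \<open>\<psi> = pi\<close> by (simp add: \<psi>_def w_def)
    qed
    then have rng': "- pi < \<psi>" "\<psi> < pi" using rng by auto
    have "\<bar>\<psi>\<bar> + \<bar>\<psi> - d\<bar> = \<bar>d\<bar>"
    proof (cases "d > 0")
      case True
      then have "sin d > 0" using sin_pos d by auto
      then have "cmod w * sin \<psi> \<ge> 0" "cmod w * sin (\<psi> - d) \<le> 0"
        using t by (auto simp: s1 s2)
      then have n: "sin \<psi> \<ge> 0" "sin (\<psi> - d) \<le> 0"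
        using r by (auto simp: zero_le_mult_iff mult_le_0_iff)
      have "\<psi> \<ge> 0" using n(1) sin_pos[of "- \<psi>"] rng' by (force simp: not_le[symmetric])
      moreover have "\<psi> \<le> d" using n(2) sin_pos[of "\<psi> - d"] rng' True by force
      ultimately show ?thesis by simp
    next
      case neg: False
      then have "sin d < 0" using sin_pos[of "- d"] d False by auto
      then have "cmod w * sin \<psi> \<le> 0" "cmod w * sin (\<psi> - d) \<ge> 0"
        using t by (auto simp: s1 s2 mult_le_0_iff)
      then have n: "sin \<psi> \<le> 0" "sin (d - \<psi>) \<le> 0"
        using r sin_minus[of "\<psi> - d"] by (auto simp: zero_le_mult_iff mult_le_0_iff)
      have "\<psi> \<le> 0" using n(1) sin_pos[of "\<psi>"] rng' by force
      moreover have "\<psi> \<ge> d" using n(2) sin_pos[of "d - \<psi>"] rng' neg by force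
      ultimately show ?thesis by simp
    qed
    then show ?L using cw c by (intro exI[of _ \<psi>]) (simp add: w_def)
  qed
qed

text \<open>Division by \<open>a\<close> turns the end points into \<open>1\<close> and
  \<open>cis d\<close>, where \<open>d\<close> is the signed angle from \<open>a\<close> to
  \<open>b\<close>; then \<open>cis_arc_iff\<close> applies.\<close>

lemma trop_add_iff_sgn_segment:
  assumes eq: "cmod a = cmod b" and ne: "a + b \<noteq> 0"
  shows "c \<in> trop_add a b \<longleftrightarrow>
    (\<exists>t\<in>{0..1}. c = of_real (cmod a) * sgn (of_real (1 - t) * a + of_real t * b))"
proof -
  define r where "r = cmod a"
  have "a \<noteq> 0" "b \<noteq> 0" using assms by auto
  then have "r > 0" by (simp add: r_def)
  define \<alpha> where "\<alpha> = Arg a"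
  define d where "d = Arg (b / a)"
  have a: "a = rcis r \<alpha>" by (simp add: r_def \<alpha>_def rcis_cmod_Arg)
  have "b / a = rcis 1 d"
    using rcis_cmod_Arg[of "b / a"] \<open>a \<noteq> 0\<close> \<open>b \<noteq> 0\<close> eq by (simp add: d_def norm_divide)
  then have ba: "b = a * cis d" using \<open>a \<noteq> 0\<close> by (simp add: rcis_def field_simps)
  then have b: "b = rcis r (\<alpha> + d)" using a by (simp add: rcis_def cis_mult)
  \<comment> \<open>Among the values of \<open>Arg\<close> only \<open>pi\<close> violates the
    strict bound, and it means \<open>b = - a\<close>.\<close>
  have "d \<noteq> pi" using ne ba by auto
  then have d: "\<bar>d\<bar> < pi" using Arg_bounded[of "b / a"] by (auto simp: d_def)
  have sgn_a: "of_real r * sgn a = a" using \<open>a \<noteq> 0\<close> by (simp add: r_def sgn_eq)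
  have "c \<in> trop_add a b \<longleftrightarrow> (\<exists>\<phi>. c = rcis r \<phi> \<and> \<bar>\<alpha> - \<phi>\<bar> + \<bar>\<phi> - (\<alpha> + d)\<bar> = \<bar>\<alpha> - (\<alpha> + d)\<bar>)"
    using trop_add_arc[OF \<open>r > 0\<close>, of "\<alpha> + d" \<alpha>] d a b by auto
  also have "\<dots> \<longleftrightarrow> (\<exists>\<psi>. c = rcis r (\<alpha> + \<psi>) \<and> \<bar>\<psi>\<bar> + \<bar>\<psi> - d\<bar> = \<bar>d\<bar>)"
  proof
    assume "\<exists>\<phi>. c = rcis r \<phi> \<and> \<bar>\<alpha> - \<phi>\<bar> + \<bar>\<phi> - (\<alpha> + d)\<bar> = \<bar>\<alpha> - (\<alpha> + d)\<bar>"
    then obtain \<phi> where "c = rcis r \<phi>" "\<bar>\<alpha> - \<phi>\<bar> + \<bar>\<phi> - (\<alpha> + d)\<bar> = \<bar>\<alpha> - (\<alpha> + d)\<bar>" by blast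
    then show "\<exists>\<psi>. c = rcis r (\<alpha> + \<psi>) \<and> \<bar>\<psi>\<bar> + \<bar>\<psi> - d\<bar> = \<bar>d\<bar>"
      by (intro exI[of _ "\<phi> - \<alpha>"]) (auto simp: algebra_simps abs_minus_commute)
  next
    assume "\<exists>\<psi>. c = rcis r (\<alpha> + \<psi>) \<and> \<bar>\<psi>\<bar> + \<bar>\<psi> - d\<bar> = \<bar>d\<bar>"
    then obtain \<psi> where "c = rcis r (\<alpha> + \<psi>)" "\<bar>\<psi>\<bar> + \<bar>\<psi> - d\<bar> = \<bar>d\<bar>" by blast
    then show "\<exists>\<phi>. c = rcis r \<phi> \<and> \<bar>\<alpha> - \<phi>\<bar> + \<bar>\<phi> - (\<alpha> + d)\<bar> = \<bar>\<alpha> - (\<alpha> + d)\<bar>"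
      by (intro exI[of _ "\<alpha> + \<psi>"]) auto
  qed
  also have "\<dots> \<longleftrightarrow> (\<exists>\<psi>. c / a = cis \<psi> \<and> \<bar>\<psi>\<bar> + \<bar>\<psi> - d\<bar> = \<bar>d\<bar>)"
  proof -
    have "c = rcis r (\<alpha> + \<psi>) \<longleftrightarrow> c / a = cis \<psi>" for \<psi>
      using \<open>a \<noteq> 0\<close> \<open>r > 0\<close> unfolding a by (auto simp: rcis_def field_simps simp flip: cis_mult)
    then show ?thesis by simp
  qed
  also have "\<dots> \<longleftrightarrow> (\<exists>t\<in>{0..1}. c / a = sgn (of_real (1 - t) + of_real t * cis d))"
    by (rule cis_arc_iff[OF d])
  also have "\<dots> \<longleftrightarrow> (\<exists>t\<in>{0..1}. c = of_real (cmod a) * sgn (of_real (1 - t) * a + of_real t * b))"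
  proof -
    have "of_real (1 - t) * a + of_real t * b = a * (of_real (1 - t) + of_real t * cis d)" for t
      by (simp add: ba algebra_simps)
    then have "of_real (cmod a) * sgn (of_real (1 - t) * a + of_real t * b)
        = a * sgn (of_real (1 - t) + of_real t * cis d)" for t
      using sgn_a by (simp only: sgn_mult mult.assoc[symmetric] r_def)
    then show ?thesis using \<open>a \<noteq> 0\<close> by (simp add: field_simps)
  qed
  finally show ?thesis .
qed

section \<open>Limit points lie in the tropical graph\<close>

lemma h_add_limit_in_trop_add:
  fixes h :: "nat \<Rightarrow> real"
  assumes h: "filterlim h (at_right 0) sequentially" and a: "a \<longlonglongrightarrow> a'" and b: "b \<longlonglongrightarrow> b'"
    and c: "(\<lambda>n. h_add (h n) (a n) (b n)) \<longlonglongrightarrow> c"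
  shows "c \<in> trop_add a' b'"
proof -
  consider "cmod b' < cmod a'" | "cmod a' < cmod b'" | "cmod a' = cmod b'" "a' + b' = 0"
    | "cmod a' = cmod b'" "a' + b' \<noteq> 0"
    by linarith
  then show ?thesis
  proof cases
    case 1
    then have "c = a'"
      using LIMSEQ_unique[OF c tendsto_h_add_dominant[OF h a b]] by simp
    then show ?thesis using 1 by (simp add: trop_add_def)
  next
    case 2
    have "(\<lambda>n. h_add (h n) (b n) (a n)) \<longlonglongrightarrow> c"
      using c by (simp add: h_add_commute)
    then have "c = b'"
      using 2 LIMSEQ_unique[OF _ tendsto_h_add_dominant[OF h b a]] by simp
    then show ?thesis using 2 by (simp add: trop_add_def)
  next
    case 3
    then show ?thesis
      using cmod_h_add_limit_le[OF h a b c] by (simp add: trop_add_def)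
  next
    case 4
    then have "a' \<noteq> 0" "b' \<noteq> 0" by auto
    \<comment> \<open>The weight of the direction of \<open>b n\<close> in the mean. It need not
      converge, but compactness of the unit interval gives a convergent subsequence, along which the
      limit \<open>c\<close> is the same.\<close>
    define t where "t n = cmod (S_map (h n) (b n)) / S_mass (h n) (a n) (b n)" for n
    have "t n \<in> {0..1}" for n
      using S_mass_nonneg[of "h n" "a n" "b n"] S_mass_ge(2)[of "h n" "b n" "a n"]
      by (auto simp: t_def divide_le_eq_1 less_le)
    then obtain l s where l: "l \<in> {0..1}" and s: "strict_mono s" and ts: "(t \<circ> s) \<longlonglongrightarrow> l"
      using compact_Icc[of "0::real" 1] unfolding compact_def by metis
    define w where "w = of_real (1 - l) * sgn a' + of_real l * sgn b'"
    have w_eq: "of_real (cmod a') * w = of_real (1 - l) * a' + of_real l * b'"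
      unfolding w_def by (rule scaled_sgn_combination) (fact 4(1))
    then have "w \<noteq> 0"
      using segment_ne_0[OF 4, of l] l by auto
    have sub: "filterlim s sequentially sequentially"
      using s by (rule filterlim_subseq)
    note hs = filterlim_compose[OF h sub] and as = filterlim_compose[OF a sub]
      and bs = filterlim_compose[OF b sub] and cs = filterlim_compose[OF c sub]
    have "(\<lambda>n. of_real (1 - t (s n)) * sgn (a (s n)) + of_real (t (s n)) * sgn (b (s n))) \<longlonglongrightarrow> w"
      unfolding w_def using \<open>a' \<noteq> 0\<close> \<open>b' \<noteq> 0\<close> ts
      by (intro tendsto_intros as bs) (auto simp: o_def)
    moreover have "\<forall>\<^sub>F n in sequentially.
        of_real (1 - t (s n)) * sgn (a (s n)) + of_real (t (s n)) * sgn (b (s n))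
        = S_mean (h (s n)) (a (s n)) (b (s n))"
      \<comment> \<open>A nonzero first argument makes the mass nonzero, so that the two weights add
        up to 1.\<close>
      using tendsto_imp_eventually_ne[OF as \<open>a' \<noteq> 0\<close>]
    proof eventually_elim
      case (elim n)
      let ?M = "S_mass (h (s n)) (a (s n)) (b (s n))"
      have M: "?M \<noteq> 0" using elim by (simp add: S_mass_eq_0_iff)
      then have "1 - t (s n) = cmod (S_map (h (s n)) (a (s n))) / ?M"
        by (simp add: t_def field_simps) (simp add: S_mass_def)
      then show ?case
        by (simp add: S_mean_def t_def add_divide_distrib S_map_sgn[of _ "a (s n)"]
            S_map_sgn[of _ "b (s n)"] norm_mult norm_sgn)
    qed
    ultimately have "(\<lambda>n. S_mean (h (s n)) (a (s n)) (b (s n))) \<longlonglongrightarrow> w"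
      by (rule Lim_transform_eventually)
    then have "c = of_real (max (cmod a') (cmod b')) * sgn w"
      using \<open>w \<noteq> 0\<close> by (intro LIMSEQ_unique[OF cs] tendsto_h_add hs as bs)
    also have "\<dots> = of_real (cmod a') * sgn (of_real (cmod a') * w)"
      using \<open>b' \<noteq> 0\<close> 4(1) by (simp add: sgn_mult sgn_of_real)
    finally show ?thesis
      using l by (auto simp: trop_add_iff_sgn_segment[OF 4] w_eq)
  qed
qed

section \<open>Points of the tropical graph are limit points\<close>

lemma h_add_limit_in_closure:
  assumes a: "(a \<longlongrightarrow> a') (at_right 0)" and b: "(b \<longlongrightarrow> b') (at_right 0)"
    and c: "((\<lambda>h. h_add h (a h) (b h)) \<longlongrightarrow> c) (at_right 0)"
  shows "((a', b', c), 0) \<in> closure h_add_graphs"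
proof (rule Lim_in_closed_set[OF closed_closure _ trivial_limit_at_right_real])
  show "((\<lambda>h. ((a h, b h, h_add h (a h) (b h)), h)) \<longlongrightarrow> ((a', b', c), 0)) (at_right 0)"
    by (intro tendsto_intros a b c)
  have "\<forall>\<^sub>F h in at_right 0. (h::real) > 0"
    by (rule eventually_at_right_less)
  then show "\<forall>\<^sub>F h in at_right 0. ((a h, b h, h_add h (a h) (b h)), h) \<in> closure h_add_graphs"
  proof eventually_elim
    case (elim h)
    then show ?case
      by (intro subsetD[OF closure_subset]) (auto simp: h_add_graphs_def)
  qed
qed

text \<open>This reaches boundary points of arcs and disks: shrink one entry by
  \<open>x < 1\<close>, then let \<open>x\<close> tend to 1.\<close>

lemma closed_limit_at_left_1:
  fixes f :: "real \<Rightarrow> 'a::topological_space"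
  assumes "closed S" "(f \<longlongrightarrow> l) (at_left 1)" "\<And>x. 0 \<le> x \<Longrightarrow> x < 1 \<Longrightarrow> f x \<in> S"
  shows "l \<in> S"
proof (rule Lim_in_closed_set[OF assms(1) _ trivial_limit_at_left_real assms(2)])
  have "\<forall>\<^sub>F x in at_left 1. x \<in> {0<..<1::real}"
    by (rule eventually_at_left_real) simp
  then show "\<forall>\<^sub>F x in at_left 1. f x \<in> S"
    by eventually_elim (use assms(3) in auto)
qed

lemma dominant_in_closure:
  assumes "cmod b < cmod a"
  shows "((a, b, a), 0) \<in> closure h_add_graphs" "((b, a, a), 0) \<in> closure h_add_graphs"
proof -
  have lim: "((\<lambda>h. h_add h a b) \<longlongrightarrow> a) (at_right 0)"
    by (rule tendsto_h_add_dominant[OF filterlim_ident tendsto_const tendsto_const assms])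
  then show "((a, b, a), 0) \<in> closure h_add_graphs"
    by (intro h_add_limit_in_closure[of "\<lambda>_. a" _ "\<lambda>_. b"] tendsto_const)
  have "((\<lambda>h. h_add h b a) \<longlongrightarrow> a) (at_right 0)"
    using lim by (simp add: h_add_commute)
  then show "((b, a, a), 0) \<in> closure h_add_graphs"
    by (intro h_add_limit_in_closure[of "\<lambda>_. b" _ "\<lambda>_. a"] tendsto_const)
qed

lemma tendsto_scaled_at_left_1:
  fixes z :: complex
  shows "((\<lambda>x. of_real x * z) \<longlongrightarrow> z) (at_left 1)"
proof -
  have "((\<lambda>x. of_real x * z) \<longlongrightarrow> of_real 1 * z) (at_left (1::real))"
    by (intro tendsto_intros)
  then show ?thesis by simp
qed

text \<open>Shrinking \<open>b\<close> makes \<open>a\<close> strictly dominant. This supplies the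
  end points of the arc.\<close>

lemma dominant_boundary_in_closure:
  assumes "cmod a = cmod b" "a \<noteq> 0"
  shows "((a, b, a), 0) \<in> closure h_add_graphs" "((b, a, a), 0) \<in> closure h_add_graphs"
proof -
  have "cmod a > 0" using assms(2) by simp
  have less: "cmod (of_real x * b) < cmod a" if "0 \<le> x" "x < 1" for x
    using that mult_strict_right_mono[of x 1 "cmod a"] \<open>cmod a > 0\<close> assms(1)
    by (simp add: norm_mult)
  show "((a, b, a), 0) \<in> closure h_add_graphs"
    by (rule closed_limit_at_left_1[of _ "\<lambda>x. ((a, of_real x * b, a), 0)"])
       (auto intro!: tendsto_intros tendsto_scaled_at_left_1 dominant_in_closure less)
  show "((b, a, a), 0) \<in> closure h_add_graphs"
    by (rule closed_limit_at_left_1[of _ "\<lambda>x. ((of_real x * b, a, a), 0)"])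
       (auto intro!: tendsto_intros tendsto_scaled_at_left_1 dominant_in_closure less)
qed

text \<open>The bijection \<open>S_map h\<close> transports addition to \<open>h_add h\<close>, and
  it is odd; so the group laws carry over with the usual negation.\<close>

lemma h_add_minus_cancel:
  assumes "h > 0"
  shows "h_add h a (h_add h c (- a)) = c"
proof -
  have "bij (S_map h)" using assms by (rule bij_S_map)
  then show ?thesis
    by (simp add: h_add_def S_map_minus bij_is_surj surj_f_inv_f bij_is_inj)
qed

text \<open>The second argument is solved for exactly, so the sum is constantly \<open>c\<close>;
  dominance of \<open>- a\<close> over \<open>c\<close> drives that argument to
  \<open>- a\<close>.\<close>

lemma open_disk_in_closure:
  assumes "cmod c < cmod a"
  shows "((a, - a, c), 0) \<in> closure h_add_graphs"
proof (rule h_add_limit_in_closure[of "\<lambda>_. a" _ "\<lambda>h. h_add h c (- a)"])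
  have "((\<lambda>h. h_add h (- a) c) \<longlongrightarrow> - a) (at_right 0)"
    by (rule tendsto_h_add_dominant[OF filterlim_ident tendsto_const tendsto_const])
       (use assms in simp)
  then show "((\<lambda>h. h_add h c (- a)) \<longlongrightarrow> - a) (at_right 0)"
    by (simp add: h_add_commute)
  have "\<forall>\<^sub>F h in at_right 0. (h::real) > 0"
    by (rule eventually_at_right_less)
  then have "\<forall>\<^sub>F h in at_right 0. c = h_add h a (h_add h c (- a))"
    by eventually_elim (simp add: h_add_minus_cancel)
  with tendsto_const show "((\<lambda>h. h_add h a (h_add h c (- a))) \<longlongrightarrow> c) (at_right 0)"
    by (rule Lim_transform_eventually)
qed simp

lemma closed_disk_in_closure:
  assumes "cmod c \<le> cmod a"
  shows "((a, - a, c), 0) \<in> closure h_add_graphs"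
proof (cases "a = 0")
  \<comment> \<open>The open disk is empty here, so its centre cannot be approached from
    inside.\<close>
  case True
  have "\<forall>\<^sub>F h in at_right 0. (h::real) > 0"
    by (rule eventually_at_right_less)
  then have "\<forall>\<^sub>F h in at_right 0. 0 = h_add h 0 0"
    by eventually_elim (simp add: h_add_zero)
  with tendsto_const have "((\<lambda>h. h_add h 0 0) \<longlongrightarrow> 0) (at_right 0)"
    by (rule Lim_transform_eventually)
  then show ?thesis
    using True assms h_add_limit_in_closure[of "\<lambda>_. 0" 0 "\<lambda>_. 0" 0 0] by simp
next
  case False
  have less: "cmod (of_real x * c) < cmod a" if "0 \<le> x" "x < 1" for x
  proof -
    have "x * cmod c \<le> x * cmod a" using assms that by (simp add: mult_left_mono)
    also have "\<dots> < cmod a" using False that by simp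
    finally show ?thesis using that by (simp add: norm_mult)
  qed
  show ?thesis
    by (rule closed_limit_at_left_1[of _ "\<lambda>x. ((a, - a, of_real x * c), 0)"])
       (auto intro!: tendsto_intros tendsto_scaled_at_left_1 open_disk_in_closure less)
qed

text \<open>The rescaled arguments have images of moduli \<open>(1 - t) * R\<close> and
  \<open>t * R\<close>, which sum to \<open>R\<close>. Hence the mean equals \<open>w\<close> for
  every positive \<open>h\<close>, not merely in the limit.\<close>

lemma arc_interior_in_closure:
  assumes eq: "cmod a = cmod b" and ne: "a + b \<noteq> 0" and t: "0 < t" "t < 1"
  shows "((a, b, of_real (cmod a) * sgn (of_real (1 - t) * a + of_real t * b)), 0)
    \<in> closure h_add_graphs"
proof -
  define a1 where "a1 h = of_real ((1 - t) powr h) * a" for h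
  define b1 where "b1 h = of_real (t powr h) * b" for h
  define w where "w = of_real (1 - t) * sgn a + of_real t * sgn b"
  have "a \<noteq> 0" "b \<noteq> 0" using assms by auto
  have w_eq: "of_real (cmod a) * w = of_real (1 - t) * a + of_real t * b"
    unfolding w_def by (rule scaled_sgn_combination) (fact eq)
  then have "w \<noteq> 0" using segment_ne_0[OF eq ne, of t] t by auto
  \<comment> \<open>The power with exponent 0 is 1 only for a nonzero base; the end points of the
    arc are therefore treated separately.\<close>
  have "((\<lambda>h. of_real ((1 - t) powr h) * a) \<longlongrightarrow> of_real ((1 - t) powr 0) * a) (at_right 0)"
    using t by (intro tendsto_intros) auto
  then have a1: "(a1 \<longlongrightarrow> a) (at_right 0)" using t by (simp add: a1_def[abs_def])
  have "((\<lambda>h. of_real (t powr h) * b) \<longlongrightarrow> of_real (t powr 0) * b) (at_right 0)"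
    using t by (intro tendsto_intros) auto
  then have b1: "(b1 \<longlongrightarrow> b) (at_right 0)" using t by (simp add: b1_def[abs_def])
  have "\<forall>\<^sub>F h in at_right 0. (h::real) > 0"
    by (rule eventually_at_right_less)
  then have "\<forall>\<^sub>F h in at_right 0. w = S_mean h (a1 h) (b1 h)"
  proof eventually_elim
    case (elim h)
    define R where "R = cmod a powr (1 / h)"
    have "R > 0" using \<open>a \<noteq> 0\<close> by (simp add: R_def)
    have Sa: "S_map h (a1 h) = of_real R * (of_real (1 - t) * sgn a)"
      using elim t by (simp add: a1_def S_map_powr_mult del: of_real_diff)
                      (simp add: S_map_sgn R_def)
    have Sb: "S_map h (b1 h) = of_real R * (of_real t * sgn b)"
      using elim t by (simp add: b1_def S_map_powr_mult) (simp add: S_map_sgn R_def eq)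
    have "cmod (of_real (1 - t) :: complex) = 1 - t"
      using t by (simp only: norm_of_real)
    then have "S_mass h (a1 h) (b1 h) = R"
      using t \<open>R > 0\<close> \<open>a \<noteq> 0\<close> \<open>b \<noteq> 0\<close>
      by (simp add: S_mass_def Sa Sb norm_mult norm_sgn algebra_simps del: of_real_diff)
    then show ?case
      using \<open>R > 0\<close> by (simp add: S_mean_def Sa Sb w_def flip: distrib_left)
  qed
  with tendsto_const have "((\<lambda>h. S_mean h (a1 h) (b1 h)) \<longlongrightarrow> w) (at_right 0)"
    by (rule Lim_transform_eventually)
  then have "((\<lambda>h. h_add h (a1 h) (b1 h)) \<longlongrightarrow> of_real (max (cmod a) (cmod b)) * sgn w) (at_right 0)"
    using \<open>w \<noteq> 0\<close> by (intro tendsto_h_add filterlim_ident a1 b1)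
  moreover have "of_real (max (cmod a) (cmod b)) * sgn w
      = of_real (cmod a) * sgn (of_real (cmod a) * w)"
    using \<open>b \<noteq> 0\<close> eq by (simp add: sgn_mult sgn_of_real)
  ultimately show ?thesis
    using h_add_limit_in_closure[OF a1 b1] by (simp add: w_eq)
qed

lemma trop_add_in_closure:
  assumes c: "c \<in> trop_add a b"
  shows "((a, b, c), 0) \<in> closure h_add_graphs"
proof -
  consider "cmod b < cmod a" | "cmod a < cmod b" | "cmod a = cmod b" "a + b = 0"
    | "cmod a = cmod b" "a + b \<noteq> 0"
    by linarith
  then show ?thesis
  proof cases
    case 1
    then show ?thesis using c dominant_in_closure(1) by (simp add: trop_add_def)
  next
    case 2
    then show ?thesis using c dominant_in_closure(2) by (simp add: trop_add_def)
  next
    case 3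
    then have "b = - a" by (simp add: eq_neg_iff_add_eq_0 add.commute)
    then show ?thesis using 3 c closed_disk_in_closure by (simp add: trop_add_def)
  next
    case 4
    then have "a \<noteq> 0" "b \<noteq> 0" by auto
    obtain t where t: "0 \<le> t" "t \<le> 1"
      and ct: "c = of_real (cmod a) * sgn (of_real (1 - t) * a + of_real t * b)"
      using c by (auto simp: trop_add_iff_sgn_segment[OF 4])
    consider "t = 0" | "t = 1" | "0 < t" "t < 1" using t by linarith
    then show ?thesis
    proof cases
      case 1
      then have "c = a" using ct \<open>a \<noteq> 0\<close> by (simp add: sgn_eq)
      then show ?thesis using dominant_boundary_in_closure(1)[OF 4(1) \<open>a \<noteq> 0\<close>] by simp
    next
      case 2
      then have "c = b" using ct \<open>b \<noteq> 0\<close> 4(1) by (simp add: sgn_eq)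
      then show ?thesis
        using dominant_boundary_in_closure(2)[OF 4(1)[symmetric] \<open>b \<noteq> 0\<close>] by simp
    next
      case 3
      then show ?thesis using arc_interior_in_closure[OF 4] ct by simp
    qed
  qed
qed

section \<open>From the closure to sequences, and the two inclusions\<close>

lemma closure_in_trop_add:
  assumes "((a, b, c), 0) \<in> closure h_add_graphs"
  shows "c \<in> trop_add a b"
proof -
  obtain x where x: "\<And>n. x n \<in> h_add_graphs" and lim: "x \<longlonglongrightarrow> ((a, b, c), 0)"
    using assms by (auto simp: closure_sequential)
  define an bn h where "an n = fst (fst (x n))" and "bn n = fst (snd (fst (x n)))"
    and "h n = snd (x n)" for n
  have cn: "snd (snd (fst (x n))) = h_add (h n) (an n) (bn n)" and pos: "h n > 0" for n
    using x[of n] by (auto simp: h_add_graphs_def an_def bn_def h_def)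
  note l1 = tendsto_fst[OF lim]
  note l2 = tendsto_snd[OF l1]
  have "h \<longlonglongrightarrow> 0" using tendsto_snd[OF lim] by (simp add: h_def[abs_def])
  then have "filterlim h (at_right 0) sequentially"
    using pos by (simp add: filterlim_at less_imp_neq[THEN not_sym])
  moreover have "an \<longlonglongrightarrow> a" using tendsto_fst[OF l1] by (simp add: an_def[abs_def])
  moreover have "bn \<longlonglongrightarrow> b" using tendsto_fst[OF l2] by (simp add: bn_def[abs_def])
  moreover have "(\<lambda>n. h_add (h n) (an n) (bn n)) \<longlonglongrightarrow> c"
    using tendsto_snd[OF l2] by (simp add: cn)
  ultimately show ?thesis by (rule h_add_limit_in_trop_add)
qed

theorem theorem9:
  shows "(UNIV \<times> {0}) \<inter> (top_of_set (UNIV \<times> {0..}) closure_of h_add_graphs)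
    = trop_add_graph \<times> {0}"
proof -
  \<comment> \<open>The closure relative to the half-space is the ambient closure cut with it, and
    the slice at 0 lies inside the half-space.\<close>
  have "h_add_graphs \<subseteq> UNIV \<times> {0..}"
    by (auto simp: h_add_graphs_def)
  then have "top_of_set (UNIV \<times> {0..}) closure_of h_add_graphs
      = (UNIV \<times> {0..}) \<inter> closure h_add_graphs"
    by (simp add: closure_of_subtopology Int_absorb1)
  then show ?thesis
    by (auto simp: trop_add_graph_def intro: trop_add_in_closure closure_in_trop_add)
qed

end
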